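(* Let $u:U\to\mathbb{R}$ be convex on $U\subset\mathbb{R}^n$ open and convex, and let $x\in U$, $r>0$. Suppose that there exists a paraboloid of radius $r$ which supports the graph of $u$ from above at $(x,u(x))$; that is, there exists a quadratic function $\varphi$ of radius $r$ whose epigraph lies above the graph of $u$ and touches it at $(x,u(x))$ (so $u\leq\varphi$ on $U$ and $u(x)=\varphi(x)$). Then $$\mathcal{K}(u,x)\leq\frac1r.$$
   Context: A quadratic function $\varphi$ on $\mathbb{R}^n$ has radius $r$ if $D^2\varphi\equiv\frac1r I$. For a convex function $u$, if $u$ is differentiable at $x$, then $$\mathcal{K}(u,x)=\limsup_{\epsilon\to0}\,2\epsilon^{-2}\max_{h\in\mathbb{S}^{n-1}}\bigl(u(x+\epsilon h)-u(x)-\epsilon\langle Du(x),h\rangle\bigr),$$ and $\mathcal{K}(u,x)=+\infty$ if $u$ is not differentiable at $x$. *)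

theory Defs
  imports "HOL-Analysis.Analysis"
begin

definition gradient :: "('a::euclidean_space \<Rightarrow> real) \<Rightarrow> 'a \<Rightarrow> 'a" where
  "gradient f x = (THE D. GDERIV f x :> D)"

lemma GDERIV_gradient:
  fixes f :: "'a::euclidean_space \<Rightarrow> real"
  assumes "f differentiable (at x)"
  shows "GDERIV f x :> gradient f x"
proof -
  obtain f' where f': "(f has_derivative f') (at x)"
    using assms unfolding differentiable_def by blast
  have lin: "linear f'"
    using f' has_derivative_linear by blast
  define D where "D = (\<Sum>b\<in>Basis. f' b *\<^sub>R b)"
  have D_eq: "f' = (\<lambda>h. h \<bullet> D)"
  proof
    fix h
    have "f' h = f' (\<Sum>b\<in>Basis. (h \<bullet> b) *\<^sub>R b)"
      by (simp add: euclidean_representation)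
    also have "\<dots> = (\<Sum>b\<in>Basis. (h \<bullet> b) * f' b)"
      by (simp add: linear_sum[OF lin] linear_scale[OF lin])
    also have "\<dots> = h \<bullet> D"
      by (simp add: D_def inner_sum_right mult.commute)
    finally show "f' h = h \<bullet> D" .
  qed
  have D: "GDERIV f x :> D"
    using f' unfolding gderiv_def D_eq .
  have "E = D" if "GDERIV f x :> E" for E
  proof -
    have "(\<lambda>h. h \<bullet> E) = (\<lambda>h. h \<bullet> D)"
      by (rule has_derivative_unique[OF that[unfolded gderiv_def] D[unfolded gderiv_def]])
    then show ?thesis
      using vector_eq_ldot[of E D] by (simp add: fun_eq_iff)
  qed
  then show ?thesis
    unfolding gradient_def by (rule theI[of "\<lambda>D. GDERIV f x :> D", OF D])
qed

definition quadratic_function :: "('a::euclidean_space \<Rightarrow> real) \<Rightarrow> bool" where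
  "quadratic_function \<phi> \<longleftrightarrow>
     (\<exists>B b c. bilinear B \<and> (\<forall>y. \<phi> y = B y y + b \<bullet> y + c))"

text \<open>The second derivative is the derivative of the gradient, so the last conjunct says that
  the Hessian of \<open>\<phi>\<close> at every point is the identity divided by \<open>r\<close>.\<close>

definition quadratic_of_radius :: "real \<Rightarrow> ('a::euclidean_space \<Rightarrow> real) \<Rightarrow> bool" where
  "quadratic_of_radius r \<phi> \<longleftrightarrow>
     quadratic_function \<phi> \<and>
     (\<forall>y. \<phi> differentiable (at y)) \<and>
     (\<forall>y. (gradient \<phi> has_derivative (\<lambda>h. (1 / r) *\<^sub>R h)) (at y))"

text \<open>A function on an open set \<open>U\<close> is represented by a total function whose values outside \<open>U\<close>
  are irrelevant: for \<open>x \<in> U\<close> both differentiability at \<open>x\<close> and the upper limit only see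
  the values near \<open>x\<close>. The supremum over the unit sphere is taken in the extended reals; it is
  an attained maximum for small \<open>\<epsilon>\<close> when \<open>u\<close> is convex, since \<open>u\<close> is then continuous near \<open>x\<close>.
  The expression is invariant under simultaneously changing the signs of \<open>\<epsilon>\<close> and \<open>h\<close>, so the two-sided
  limit agrees with the one through positive \<open>\<epsilon>\<close>.\<close>

definition curvature :: "('a::euclidean_space \<Rightarrow> real) \<Rightarrow> 'a \<Rightarrow> ereal" where
  "curvature u x =
     (if u differentiable (at x)
      then Limsup (at 0) (\<lambda>\<epsilon>::real. ereal (2 / \<epsilon>\<^sup>2) *
             (SUP h\<in>sphere 0 1. ereal (u (x + \<epsilon> *\<^sub>R h) - u x - \<epsilon> * (gradient u x \<bullet> h))))
      else \<infinity>)"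

end

theory Submission
  imports Defs
begin

text \<open>
  Write \<open>p\<close> for the gradient of the paraboloid \<open>\<phi>\<close> at the contact point \<open>x\<close> and put
  \<open>g h = u (x + h) - u x - h \<bullet> p\<close>.  Integrating the Hessian of \<open>\<phi>\<close> twice shows that
  \<open>\<phi> (x + h)\<close> equals \<open>\<phi> x + h \<bullet> p + \<bar>h\<bar>\<^sup>2 / (2 r)\<close>
  (lemma \<open>quadratic_of_radius_expansion\<close>), so the contact from above says
  \<open>g h \<le> \<bar>h\<bar>\<^sup>2 / (2 r)\<close> for small \<open>h\<close>.  The opposite bound comes from convexity: \<open>g\<close> is
  convex and vanishes at the origin, the midpoint of \<open>h\<close> and \<open>-h\<close>, hence \<open>g h \<ge> - g (-h)\<close>, and
  the upper bound at \<open>-h\<close> is a lower bound at \<open>h\<close>.  Thus \<open>g\<close> is squeezed between two multiples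
  of \<open>\<bar>h\<bar>\<^sup>2\<close>, which makes \<open>u\<close> differentiable at \<open>x\<close> with gradient \<open>p\<close>
  (lemma \<open>GDERIV_of_quadratic_upper_bound\<close>).
  Now \<open>g\<close> is exactly the remainder measured by the curvature, and its upper bound
  yields the claim at every sufficiently small scale.
\<close>

lemma gradient_eq:
  fixes f :: "'a::euclidean_space \<Rightarrow> real"
  assumes "GDERIV f x :> D"
  shows "gradient f x = D"
proof -
  have "f differentiable (at x)"
    using assms unfolding gderiv_def differentiable_def by blast
  from GDERIV_gradient[OF this]
  have "(\<lambda>h. h \<bullet> gradient f x) = (\<lambda>h. h \<bullet> D)"
    using assms unfolding gderiv_def by (rule has_derivative_unique)
  then show ?thesis
    using vector_eq_ldot[of "gradient f x" D] by (simp add: fun_eq_iff)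
qed

text \<open>The Hessian condition integrates twice: \<open>gradient \<phi> y - (1 / r) *\<^sub>R y\<close> has zero derivative
  and is therefore constant, and then so is the difference of \<open>\<phi>\<close> and its second-order expansion.\<close>

lemma quadratic_of_radius_expansion:
  fixes \<phi> :: "'a::euclidean_space \<Rightarrow> real"
  assumes "quadratic_of_radius r \<phi>"
  shows "\<phi> (x + h) = \<phi> x + h \<bullet> gradient \<phi> x + (norm h)\<^sup>2 / (2 * r)"
proof -
  have diff: "GDERIV \<phi> y :> gradient \<phi> y"
    and hess: "(gradient \<phi> has_derivative (\<lambda>h. (1 / r) *\<^sub>R h)) (at y)" for y
    using assms GDERIV_gradient unfolding quadratic_of_radius_def by blast+
  define G where "G y = gradient \<phi> y - (1 / r) *\<^sub>R y" for y
  have "(G has_derivative (\<lambda>h. 0)) (at y)" for y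
    unfolding G_def
    using has_derivative_diff[OF hess[of y]
        has_derivative_scaleR_right[OF has_derivative_ident, of "1 / r"]]
    by simp
  then have G: "G y = G x" for y
    using has_derivative_zero_unique[of UNIV G y x] by simp
  have grad: "gradient \<phi> y = gradient \<phi> x + (1 / r) *\<^sub>R (y - x)" for y
  proof -
    have "gradient \<phi> y = G y + (1 / r) *\<^sub>R y"
      by (simp only: G_def diff_add_cancel)
    also have "\<dots> = gradient \<phi> x - (1 / r) *\<^sub>R x + (1 / r) *\<^sub>R y"
      unfolding G[of y] unfolding G_def by (rule refl)
    finally show ?thesis
      by (simp only: scaleR_diff_right add_diff_eq diff_add_eq)
  qed
  define \<psi> where "\<psi> y = \<phi> y - (y - x) \<bullet> gradient \<phi> x - (y - x) \<bullet> (y - x) / (2 * r)" for y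
  have "(\<psi> has_derivative (\<lambda>h. 0)) (at y)" for y
  proof -
    have d: "((\<lambda>y. y - x) has_derivative (\<lambda>h. h)) (at y)"
      using has_derivative_diff[OF has_derivative_ident has_derivative_const] by simp
    have "(\<psi> has_derivative (\<lambda>h. h \<bullet> gradient \<phi> y - h \<bullet> gradient \<phi> x
        - ((y - x) \<bullet> h + h \<bullet> (y - x)) / (2 * r))) (at y)"
      unfolding \<psi>_def divide_inverse
      by (intro has_derivative_diff has_derivative_mult_left has_derivative_inner_left
          has_derivative_inner diff[unfolded gderiv_def] d)
    also have "(\<lambda>h. h \<bullet> gradient \<phi> y - h \<bullet> gradient \<phi> x
        - ((y - x) \<bullet> h + h \<bullet> (y - x)) / (2 * r)) = (\<lambda>h. 0)"
      unfolding grad[of y] by (simp add: fun_eq_iff inner_add_right inner_commute)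
    finally show ?thesis .
  qed
  then have "\<psi> (x + h) = \<psi> x"
    using has_derivative_zero_unique[of UNIV \<psi> "x + h" x] by simp
  then show ?thesis
    by (simp add: \<psi>_def power2_norm_eq_inner)
qed

text \<open>Convexity turns a second-order upper bound into a two-sided one: since \<open>u x\<close> is at most the
  mean of \<open>u (x + h)\<close> and \<open>u (x - h)\<close>, the linear terms cancel and the bound for \<open>- h\<close> becomes
  a lower bound for \<open>h\<close>.\<close>

lemma GDERIV_of_quadratic_upper_bound:
  fixes u :: "'a::euclidean_space \<Rightarrow> real"
  assumes "0 < \<delta>" and conv: "convex_on (ball x \<delta>) u"
    and upper: "\<And>h. norm h < \<delta> \<Longrightarrow> u (x + h) \<le> u x + h \<bullet> p + C * (norm h)\<^sup>2"
  shows "GDERIV u x :> p"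
proof -
  have bound: "\<bar>u y - u x - (y - x) \<bullet> p\<bar> / norm (y - x) \<le> C * norm (y - x)"
    if "y \<in> ball x \<delta>" "y \<noteq> x" for y
  proof -
    define h where "h = y - x"
    have h: "norm h < \<delta>" "h \<noteq> 0" "y = x + h"
      using that by (auto simp: h_def dist_norm norm_minus_commute)
    have "u ((1 - 1/2) *\<^sub>R (x + h) + (1/2) *\<^sub>R (x - h)) \<le> (1 - 1/2) * u (x + h) + (1/2) * u (x - h)"
      by (rule convex_onD[OF conv]) (use h in \<open>auto simp: dist_norm\<close>)
    moreover have "(1 - 1/2) *\<^sub>R (x + h) + (1/2) *\<^sub>R (x - h) = x"
      by (simp add: algebra_simps flip: scaleR_left_distrib)
    ultimately have "2 * u x \<le> u (x + h) + u (x - h)"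
      by simp
    then have "\<bar>u (x + h) - u x - h \<bullet> p\<bar> \<le> C * (norm h)\<^sup>2"
      using upper[of h] upper[of "- h"] h by simp
    then have "\<bar>u (x + h) - u x - h \<bullet> p\<bar> / norm h \<le> C * norm h"
      using h by (simp add: divide_le_eq power2_eq_square mult.assoc)
    then show ?thesis
      using h by simp
  qed
  have "\<forall>\<^sub>F y in at x. y \<in> ball x \<delta>"
    by (rule eventually_at_in_open') (use \<open>0 < \<delta>\<close> in auto)
  then have ev: "\<forall>\<^sub>F y in at x. \<bar>u y - u x - (y - x) \<bullet> p\<bar> / norm (y - x) \<le> C * norm (y - x)"
    using eventually_neq_at_within[of x x UNIV] by eventually_elim (use bound in auto)
  have "((\<lambda>y. C * norm (y - x)) \<longlongrightarrow> C * norm (x - x)) (at x)"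
    by (intro tendsto_intros)
  then have "((\<lambda>y. \<bar>u y - u x - (y - x) \<bullet> p\<bar> / norm (y - x)) \<longlongrightarrow> 0) (at x)"
    by (intro tendsto_sandwich[OF _ ev tendsto_const]) (auto intro!: always_eventually)
  then show ?thesis
    unfolding gderiv_def has_derivative_iff_norm by (auto intro: bounded_linear_inner_left)
qed

theorem lemma3p20:
  fixes U :: "(real ^ 'n) set" and u :: "real ^ 'n \<Rightarrow> real"
    and x :: "real ^ 'n" and r :: real
  assumes "open U" and "convex U" and "convex_on U u"
    and "x \<in> U" and "r > 0"
    and "\<exists>\<phi>. quadratic_of_radius r \<phi> \<and> (\<forall>y\<in>U. u y \<le> \<phi> y) \<and> u x = \<phi> x"
  shows "curvature u x \<le> ereal (1 / r)"
proof -
  obtain \<phi> where \<phi>: "quadratic_of_radius r \<phi>" "\<And>y. y \<in> U \<Longrightarrow> u y \<le> \<phi> y" "u x = \<phi> x"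
    using assms by blast
  obtain \<delta> where \<delta>: "0 < \<delta>" "ball x \<delta> \<subseteq> U"
    using \<open>open U\<close> \<open>x \<in> U\<close> openE by blast
  define p where "p = gradient \<phi> x"
  have upper: "u (x + h) \<le> u x + h \<bullet> p + 1 / (2 * r) * (norm h)\<^sup>2" if "norm h < \<delta>" for h
  proof -
    have "x + h \<in> U"
      using \<delta>(2) that by (auto simp: dist_norm)
    from \<phi>(2)[OF this] show ?thesis
      using quadratic_of_radius_expansion[OF \<phi>(1), of x h] \<phi>(3) by (simp add: p_def)
  qed
  have "convex_on (ball x \<delta>) u"
    using \<open>convex_on U u\<close> \<delta>(2) convex_ball by (rule convex_on_subset)
  then have D: "GDERIV u x :> p"
    by (rule GDERIV_of_quadratic_upper_bound[OF \<delta>(1) _ upper])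
  then have grad: "gradient u x = p"
    by (rule gradient_eq)
  have quotient: "ereal (2 / \<epsilon>\<^sup>2) *
      (SUP h\<in>sphere 0 1. ereal (u (x + \<epsilon> *\<^sub>R h) - u x - \<epsilon> * (gradient u x \<bullet> h))) \<le> ereal (1 / r)"
    if "\<bar>\<epsilon>\<bar> < \<delta>" "\<epsilon> \<noteq> 0" for \<epsilon>
  proof -
    have "u (x + \<epsilon> *\<^sub>R h) - u x - \<epsilon> * (gradient u x \<bullet> h) \<le> \<epsilon>\<^sup>2 / (2 * r)"
      if "h \<in> sphere 0 1" for h
      using upper[of "\<epsilon> *\<^sub>R h"] that \<open>\<bar>\<epsilon>\<bar> < \<delta>\<close> by (simp add: grad inner_commute)
    then have "(SUP h\<in>sphere 0 1. ereal (u (x + \<epsilon> *\<^sub>R h) - u x - \<epsilon> * (gradient u x \<bullet> h)))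
        \<le> ereal (\<epsilon>\<^sup>2 / (2 * r))"
      by (intro SUP_least) simp
    then have "ereal (2 / \<epsilon>\<^sup>2) *
        (SUP h\<in>sphere 0 1. ereal (u (x + \<epsilon> *\<^sub>R h) - u x - \<epsilon> * (gradient u x \<bullet> h)))
        \<le> ereal (2 / \<epsilon>\<^sup>2) * ereal (\<epsilon>\<^sup>2 / (2 * r))"
      by (rule ereal_mult_left_mono) simp
    also have "\<dots> = ereal (1 / r)"
      using that by simp
    finally show ?thesis .
  qed
  have "\<forall>\<^sub>F \<epsilon> in at 0. ereal (2 / \<epsilon>\<^sup>2) *
      (SUP h\<in>sphere 0 1. ereal (u (x + \<epsilon> *\<^sub>R h) - u x - \<epsilon> * (gradient u x \<bullet> h))) \<le> ereal (1 / r)"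
    unfolding eventually_at using \<delta>(1) quotient by (auto simp: dist_real_def)
  then have "Limsup (at 0) (\<lambda>\<epsilon>. ereal (2 / \<epsilon>\<^sup>2) *
      (SUP h\<in>sphere 0 1. ereal (u (x + \<epsilon> *\<^sub>R h) - u x - \<epsilon> * (gradient u x \<bullet> h)))) \<le> ereal (1 / r)"
    by (rule Limsup_bounded)
  moreover have "u differentiable (at x)"
    using D unfolding gderiv_def differentiable_def by blast
  ultimately show ?thesis
    by (simp add: curvature_def)
qed

end
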